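(* A Boolean algebra $\mathfrak A$ is uniformly weakly Radon-Nikod\'ym (UWRN) if and only if there is a decomposition $\mathfrak A=\bigcup_{n\ge 1}\mathcal E_n$ such that, for every $n\ge1$, $\mathcal E_n$ contains no independent sequence of length $n$. Consequently, the class of UWRN algebras is stable under taking subalgebras: every subalgebra of a UWRN algebra is UWRN.
   Context: A family $\{a_i:i\in I\}$ in a Boolean algebra is independent if $\bigcap_{i\in I'}a_i\cap\bigcap_{i\in I''}a_i^c\neq 0$ for all finite disjoint $I',I''\subseteq I$. A Boolean algebra $\mathfrak A$ is UWRN if it is generated by a family $\mathcal G=\bigcup_{n\ge 1}\mathcal G_n$ such that, for every $n\ge 1$, $\mathcal G_n$ contains no independent sequence of length $n$. *)

theory Defs
  imports Main "HOL.Hull"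
begin

text \<open>
  Boolean algebras are represented as subalgebras (as carrier sets) of an arbitrary type of class
  \<^class>\<open>boolean_algebra\<close>, so that an algebra and its subalgebras can be treated uniformly; the
  carrier \<^term>\<open>UNIV\<close> gives an arbitrary type of that class itself. That class admits the
  one-element algebra.
\<close>

definition boolean_subalgebra :: "'a::boolean_algebra set \<Rightarrow> bool" where
  "boolean_subalgebra A \<longleftrightarrow>
     bot \<in> A \<and> top \<in> A \<and>
     (\<forall>x\<in>A. - x \<in> A) \<and>
     (\<forall>x\<in>A. \<forall>y\<in>A. inf x y \<in> A) \<and>
     (\<forall>x\<in>A. \<forall>y\<in>A. sup x y \<in> A)"

text \<open>
  Inserting \<^term>\<open>top\<close> makes the meet of the empty family equal to \<^term>\<open>top\<close>
  (\<^const>\<open>Inf_fin\<close> is only specified on nonempty finite sets).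
\<close>

definition independent_family :: "'i set \<Rightarrow> ('i \<Rightarrow> 'a::boolean_algebra) \<Rightarrow> bool" where
  "independent_family I a \<longleftrightarrow>
     (\<forall>I' I''. finite I' \<and> finite I'' \<and> I' \<subseteq> I \<and> I'' \<subseteq> I \<and> I' \<inter> I'' = {} \<longrightarrow>
        inf (Inf_fin (insert top (a ` I'))) (Inf_fin (insert top ((\<lambda>i. - a i) ` I''))) \<noteq> bot)"

definition contains_independent_seq :: "'a::boolean_algebra set \<Rightarrow> nat \<Rightarrow> bool" where
  "contains_independent_seq X n \<longleftrightarrow>
     (\<exists>a :: nat \<Rightarrow> 'a. a ` {..<n} \<subseteq> X \<and> independent_family {..<n} a)"

lemma boolean_subalgebra_hull: "boolean_subalgebra (boolean_subalgebra hull G)"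
  by (rule hull_in) (auto simp: boolean_subalgebra_def)

text \<open>
  The subalgebra generated by a set is its \<^const>\<open>hull\<close>, the least subalgebra containing it. In
  particular \<^term>\<open>A\<close> below is a subalgebra and every \<^term>\<open>G n\<close> with \<^term>\<open>n \<ge> 1\<close>
  is contained in \<^term>\<open>A\<close>.
\<close>

definition UWRN :: "'a::boolean_algebra set \<Rightarrow> bool" where
  "UWRN A \<longleftrightarrow>
     (\<exists>G :: nat \<Rightarrow> 'a set.
        boolean_subalgebra hull (\<Union>n\<in>{1..}. G n) = A \<and>
        (\<forall>n\<ge>1. \<not> contains_independent_seq (G n) n))"

end

theory Submission
  imports Defs
begin

text \<open>
  Only one direction needs work: a decomposition of \<open>A\<close> is itself a generating family, and
  intersecting its pieces with a subalgebra \<open>B\<close> decomposes \<open>B\<close>.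

  For the converse, say that a set has bounded independence if the lengths of the independent
  sequences in it are bounded. The heart of the matter is that this property passes from \<open>X\<close> and
  \<open>Y\<close> to the set of all meets \<open>inf x y\<close> with \<open>x \<in> X\<close> and \<open>y \<in> Y\<close>
  (\<open>bounded_independence_inf\<close>). This is a counting argument. A sequence \<open>a\<close> of length \<open>N\<close> has
  \<open>2 ^ N\<close> formal cells, the meets of the elements \<open>a i\<close> or their complements, and it is independent
  iff no cell vanishes. By the Sauer-Shelah lemma, if no subsequence of length \<open>n\<close> is independent,
  then at most \<open>(N + 1) ^ n\<close> cells are nonzero. Each nonzero cell of the sequence of meets
  \<open>inf (x i) (y i)\<close> contains a nonzero meet of a cell of \<open>x\<close> with a cell of \<open>y\<close>, and this
  pair determines it. Hence the meets have at most polynomially many nonzero cells, which is less than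
  \<open>2 ^ N\<close> for large \<open>N\<close>.

  Bounded independence is also preserved by complements and finite unions. So the generated algebra
  is exhausted by an increasing sequence of sets with bounded independence: at each step adjoin
  another \<open>G n\<close> and all complements and binary meets of what is there already. Reindexing by the
  bounds gives the decomposition.
\<close>

section \<open>The Sauer-Shelah lemma\<close>

definition shatters :: "'i set set \<Rightarrow> 'i set \<Rightarrow> bool" where
  "shatters F J \<longleftrightarrow> (\<forall>T\<subseteq>J. \<exists>S\<in>F. S \<inter> J = T)"

lemma shattersE:
  assumes "shatters F J" "T \<subseteq> J"
  obtains S where "S \<in> F" "S \<inter> J = T"
  using assms by (auto simp: shatters_def)

lemma shatters_mono: "shatters F J \<Longrightarrow> F \<subseteq> F' \<Longrightarrow> shatters F' J"
  unfolding shatters_def by (meson subsetD)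

text \<open>
  Pajor's form of the Sauer-Shelah lemma. Split \<open>F\<close> into the members without \<open>x\<close> and those with \<open>x\<close>.
  A set shattered by one half is shattered by \<open>F\<close>, and a set \<open>J\<close> shattered by both halves counts
  twice, because then \<open>F\<close> shatters \<open>insert x J\<close> too.
\<close>
lemma card_le_card_shattered:
  assumes "finite I" "F \<subseteq> Pow I"
  shows "card F \<le> card {J. J \<subseteq> I \<and> shatters F J}"
  using assms
proof (induction I arbitrary: F rule: finite_induct)
  case empty
  then have F: "F \<subseteq> {{}}" by simp
  show ?case
  proof (cases "F = {}")
    case False
    with F have "F = {{}}" by (metis subset_singletonD)
    moreover have "{J. J \<subseteq> {} \<and> shatters {{}} J} = {{}::'a set}"
      by (auto simp: shatters_def)
    ultimately show ?thesis by (simp only: order_refl)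
  qed simp
next
  case (insert x I)
  define F0 where "F0 = {S \<in> F. x \<notin> S}"
  define F1 where "F1 = {S. x \<notin> S \<and> insert x S \<in> F}"
  define Sh where "Sh H = {J. J \<subseteq> I \<and> shatters H J}" for H
  have fin: "finite (Sh H)" for H
    by (rule finite_subset[of _ "Pow I"]) (use insert.hyps in \<open>auto simp: Sh_def\<close>)
  have sub: "F0 \<subseteq> Pow I" "F1 \<subseteq> Pow I"
    using insert.prems by (auto simp: F0_def F1_def)
  then have finF: "finite F0" "finite F1"
    using insert.hyps by (meson finite_Pow_iff finite_subset)+
  have split: "F = F0 \<union> insert x ` F1"
  proof (intro equalityI subsetI)
    fix S assume "S \<in> F"
    show "S \<in> F0 \<union> insert x ` F1"
    proof (cases "x \<in> S")
      case True
      then have "S = insert x (S - {x})" by blast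
      moreover have "S - {x} \<in> F1" using \<open>S \<in> F\<close> True by (simp add: F1_def insert_absorb)
      ultimately show ?thesis by blast
    qed (use \<open>S \<in> F\<close> in \<open>auto simp: F0_def\<close>)
  qed (auto simp: F0_def F1_def)
  have both: "shatters F (insert x J)" if "J \<in> Sh F0 \<inter> Sh F1" for J
    unfolding shatters_def
  proof (intro allI impI)
    fix T assume T: "T \<subseteq> insert x J"
    have J: "shatters F0 J" "shatters F1 J" using that by (simp_all add: Sh_def)
    have xJ: "x \<notin> J" using that insert.hyps by (auto simp: Sh_def)
    show "\<exists>S\<in>F. S \<inter> insert x J = T"
    proof (cases "x \<in> T")
      case True
      have "T - {x} \<subseteq> J" using T by blast
      then obtain S where S: "S \<in> F1" "S \<inter> J = T - {x}"
        using shattersE[OF J(2)] by metis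
      have "insert x S \<inter> insert x J = insert x (S \<inter> J)" by blast
      also have "\<dots> = T" unfolding S(2) using True by blast
      finally have "insert x S \<inter> insert x J = T" .
      moreover have "insert x S \<in> F" using S(1) by (simp add: F1_def)
      ultimately show ?thesis by (rule bexI)
    next
      case False
      then have "T \<subseteq> J" using T by blast
      then obtain S where S: "S \<in> F0" "S \<inter> J = T"
        using shattersE[OF J(1)] by metis
      have "x \<notin> S" "S \<in> F" using S(1) by (simp_all add: F0_def)
      moreover from this have "S \<inter> insert x J = T" using S(2) by simp
      ultimately show ?thesis by (intro bexI)
    qed
  qed
  have one: "shatters F J" if "J \<in> Sh F0 \<union> Sh F1" for J
  proof (cases "J \<in> Sh F0")
    case True
    then show ?thesis using shatters_mono[of F0 J F] by (auto simp: Sh_def F0_def)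
  next
    case False
    then have J: "shatters F1 J" "x \<notin> J" using that insert.hyps by (auto simp: Sh_def)
    show ?thesis unfolding shatters_def
    proof (intro allI impI)
      fix T assume "T \<subseteq> J"
      then obtain S where S: "S \<in> F1" "S \<inter> J = T" using shattersE[OF J(1)] by metis
      have "insert x S \<inter> J = T" using S(2) J(2) by simp
      moreover have "insert x S \<in> F" using S(1) by (simp add: F1_def)
      ultimately show "\<exists>S\<in>F. S \<inter> J = T" by (rule bexI)
    qed
  qed
  have "card F \<le> card F0 + card (insert x ` F1)"
    unfolding split by (rule card_Un_le)
  also have "\<dots> \<le> card F0 + card F1"
    using finF by (simp add: card_image_le)
  also have "\<dots> \<le> card (Sh F0) + card (Sh F1)"
    using insert.IH[OF sub(1)] insert.IH[OF sub(2)] by (simp add: Sh_def)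
  also have "\<dots> = card (Sh F0 \<union> Sh F1) + card (Sh F0 \<inter> Sh F1)"
    by (rule card_Un_Int[OF fin fin])
  also have "card (Sh F0 \<inter> Sh F1) = card (insert x ` (Sh F0 \<inter> Sh F1))"
    using insert.hyps by (intro card_image[symmetric] inj_onI) (auto simp: Sh_def)
  also have "card (Sh F0 \<union> Sh F1) + \<dots> =
      card ((Sh F0 \<union> Sh F1) \<union> insert x ` (Sh F0 \<inter> Sh F1))"
    using insert.hyps fin by (intro card_Un_disjoint[symmetric]) (auto simp: Sh_def)
  also have "\<dots> \<le> card {J. J \<subseteq> insert x I \<and> shatters F J}"
  proof (rule card_mono)
    show "finite {J. J \<subseteq> insert x I \<and> shatters F J}"
      by (rule finite_subset[of _ "Pow (insert x I)"]) (use insert.hyps in auto)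
    show "(Sh F0 \<union> Sh F1) \<union> insert x ` (Sh F0 \<inter> Sh F1)
        \<subseteq> {J. J \<subseteq> insert x I \<and> shatters F J}"
      using one both by (auto simp: Sh_def)
  qed
  finally show ?case .
qed

lemma card_small_subsets_le:
  assumes "finite I"
  shows "card {J. J \<subseteq> I \<and> card J < n} \<le> (card I + 1) ^ n"
proof (induction n)
  case 0
  then show ?case by simp
next
  case (Suc n)
  let ?B = "{J. J \<subseteq> I \<and> card J < n}"
  have finB: "finite ?B"
    by (rule finite_subset[of _ "Pow I"]) (use assms in auto)
  have "{J. J \<subseteq> I \<and> card J < Suc n} \<subseteq> insert {} ((\<lambda>(i, J). insert i J) ` (I \<times> ?B))"
  proof
    fix J assume J: "J \<in> {J. J \<subseteq> I \<and> card J < Suc n}"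
    show "J \<in> insert {} ((\<lambda>(i, J). insert i J) ` (I \<times> ?B))"
    proof (cases "J = {}")
      case False
      then obtain i where i: "i \<in> J" by blast
      have "finite J" using J assms finite_subset by blast
      then have "card (J - {i}) < card J" using i by (rule card_Diff1_less)
      then have "card (J - {i}) < n" using J by simp
      then have "(i, J - {i}) \<in> I \<times> ?B" using J i by auto
      moreover have "J = (\<lambda>(i, J). insert i J) (i, J - {i})" using i by auto
      ultimately show ?thesis by blast
    qed simp
  qed
  then have "card {J. J \<subseteq> I \<and> card J < Suc n}
      \<le> card (insert {} ((\<lambda>(i, J). insert i J) ` (I \<times> ?B)))"
    by (intro card_mono) (use finB assms in auto)
  also have "\<dots> \<le> Suc (card ((\<lambda>(i, J). insert i J) ` (I \<times> ?B)))"
    by (rule card_insert_le_m1) auto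
  also have "\<dots> \<le> Suc (card (I \<times> ?B))"
    using card_image_le[of "I \<times> ?B" "\<lambda>(i, J). insert i J"] finB assms by simp
  also have "\<dots> \<le> 1 + card I * (card I + 1) ^ n"
    using Suc.IH by (simp add: card_cartesian_product)
  also have "\<dots> \<le> (card I + 1) ^ Suc n"
    by simp
  finally show ?case .
qed

lemma sauer_shelah:
  assumes "finite I" "F \<subseteq> Pow I" "\<And>J. J \<subseteq> I \<Longrightarrow> shatters F J \<Longrightarrow> card J < n"
  shows "card F \<le> (card I + 1) ^ n"
proof -
  have "card F \<le> card {J. J \<subseteq> I \<and> shatters F J}"
    using card_le_card_shattered[OF assms(1,2)] .
  also have "\<dots> \<le> card {J. J \<subseteq> I \<and> card J < n}"
    by (rule card_mono) (use assms in auto)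
  also have "\<dots> \<le> (card I + 1) ^ n"
    by (rule card_small_subsets_le[OF assms(1)])
  finally show ?thesis .
qed

text \<open>
  A fixed power of \<open>N + 1\<close>, which bounds the number of nonzero cells, falls short of the number of
  all formal cells for some \<open>N\<close>.
\<close>
lemma ex_power_less_exp: "\<exists>N. (N + 1) ^ p < (2::nat) ^ N"
proof -
  define j where "j = 2 * p + 1"
  \<comment> \<open>With \<open>N + 1\<close> a power of two, only the exponents \<open>2 * j * p\<close> and \<open>N\<close> have to be compared.\<close>
  define N where "N = (2::nat) ^ (2 * j) - 1"
  have N: "N + 1 = 2 ^ (2 * j)" by (simp add: N_def)
  have "2 * j * p = j * (2 * p)" by simp
  also have "\<dots> < j * j" unfolding j_def by (intro mult_strict_left_mono) simp_all
  also have "j * j \<le> N"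
  proof -
    have "j * j < (2::nat) ^ j * 2 ^ j" by (intro mult_strict_mono' less_exp) simp_all
    also have "\<dots> = N + 1" unfolding N mult_2 by (rule power_add[symmetric])
    finally show ?thesis by simp
  qed
  finally have "(2::nat) ^ (2 * j * p) < 2 ^ N" by (rule power_strict_increasing) simp
  moreover have "(N + 1) ^ p = 2 ^ (2 * j * p)" unfolding N by (rule power_mult[symmetric])
  ultimately show ?thesis by metis
qed

section \<open>Independence through nonzero cells\<close>

text \<open>
  The sign patterns of the nonzero cells of \<open>a\<close>; the pattern \<open>S\<close> is the set of indices that occur
  without complement. A cell is represented by the nonzero elements \<open>z\<close> below it.
\<close>
definition traces :: "'i set \<Rightarrow> ('i \<Rightarrow> 'a::boolean_algebra) \<Rightarrow> 'i set set" where
  "traces I a = {S. S \<subseteq> I \<and> (\<exists>z. z \<noteq> bot \<and> (\<forall>i\<in>S. z \<le> a i) \<and> (\<forall>i\<in>I - S. z \<le> - a i))}"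

lemma traces_cong:
  assumes "\<And>i. i \<in> I \<Longrightarrow> a i = b i"
  shows "traces I a = traces I b"
proof -
  have "(\<forall>i\<in>S. z \<le> a i) \<and> (\<forall>i\<in>I - S. z \<le> - a i) \<longleftrightarrow> (\<forall>i\<in>S. z \<le> b i) \<and> (\<forall>i\<in>I - S. z \<le> - b i)"
    if "S \<subseteq> I" for S z
    using assms that by (intro conj_cong ball_cong refl) (simp_all add: subset_iff)
  then show ?thesis by (simp add: traces_def cong: conj_cong)
qed

lemma inf_Inf_fin_neq_bot_iff:
  fixes a :: "'i \<Rightarrow> 'a::boolean_algebra"
  assumes "finite S" "finite T"
  shows "inf (Inf_fin (insert top (a ` S))) (Inf_fin (insert top ((\<lambda>i. - a i) ` T))) \<noteq> bot \<longleftrightarrow>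
    (\<exists>z. z \<noteq> bot \<and> (\<forall>i\<in>S. z \<le> a i) \<and> (\<forall>i\<in>T. z \<le> - a i))"
proof -
  have le: "z \<le> inf (Inf_fin (insert top (a ` S))) (Inf_fin (insert top ((\<lambda>i. - a i) ` T))) \<longleftrightarrow>
      (\<forall>i\<in>S. z \<le> a i) \<and> (\<forall>i\<in>T. z \<le> - a i)" for z
    using assms by (simp add: Inf_fin.bounded_iff)
  show ?thesis using le by (metis bot.extremum_uniqueI order_refl)
qed

lemma independent_family_iff:
  assumes "finite I"
  shows "independent_family I a \<longleftrightarrow> traces I a = Pow I"
proof
  assume ind: "independent_family I a"
  have "S \<in> traces I a" if "S \<subseteq> I" for S
  proof -
    have fin: "finite S" "finite (I - S)" using that assms finite_subset by auto
    with ind that show ?thesis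
      unfolding independent_family_def traces_def
      by (simp add: inf_Inf_fin_neq_bot_iff[OF fin, symmetric])
  qed
  then show "traces I a = Pow I" by (auto simp: traces_def)
next
  assume tr: "traces I a = Pow I"
  show "independent_family I a"
    unfolding independent_family_def
  proof (intro allI impI, elim conjE)
    fix S T assume *: "finite S" "finite T" "S \<subseteq> I" "T \<subseteq> I" "S \<inter> T = {}"
    then have "S \<in> traces I a" using tr by simp
    then show "inf (Inf_fin (insert top (a ` S))) (Inf_fin (insert top ((\<lambda>i. - a i) ` T))) \<noteq> bot"
      unfolding inf_Inf_fin_neq_bot_iff[OF *(1,2)] traces_def using *(4,5) by blast
  qed
qed

text \<open>
  A cell of \<open>a\<close> over the index set \<open>I\<close> lies in the cell over \<open>J\<close> with the restricted sign pattern.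
\<close>
lemma shatters_traces_imp_independent:
  assumes "finite J" "J \<subseteq> I" "shatters (traces I a) J"
  shows "independent_family J a"
  unfolding independent_family_iff[OF assms(1)]
proof
  show "Pow J \<subseteq> traces J a"
  proof
    fix T assume "T \<in> Pow J"
    then obtain S where S: "S \<in> traces I a" "S \<inter> J = T"
      using assms(3) by (auto simp: shatters_def)
    then show "T \<in> traces J a" using assms(2) unfolding traces_def by blast
  qed
qed (auto simp: traces_def)

lemma independent_family_subset:
  "independent_family I a \<Longrightarrow> J \<subseteq> I \<Longrightarrow> independent_family J a"
  unfolding independent_family_def by (meson subset_trans)

lemma independent_family_reindex:
  fixes h :: "'j \<Rightarrow> 'i"
  assumes "bij_betw h J I" "finite J" "independent_family I a"
  shows "independent_family J (a \<circ> h)"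
proof -
  have "finite I" using assms bij_betw_finite by blast
  then have tr: "traces I a = Pow I" using assms(3) independent_family_iff by blast
  have "S \<in> traces J (a \<circ> h)" if S: "S \<subseteq> J" for S
  proof -
    have "h ` S \<in> traces I a" using tr S assms(1) by (auto simp: bij_betw_def)
    then obtain z where z: "z \<noteq> bot" "\<forall>i\<in>h ` S. z \<le> a i" "\<forall>i\<in>I - h ` S. z \<le> - a i"
      by (auto simp: traces_def)
    have "h j \<in> I - h ` S" if "j \<in> J - S" for j
      using that S assms(1) by (auto simp: bij_betw_def inj_on_def)
    then show ?thesis using z S by (auto simp: traces_def)
  qed
  then show ?thesis unfolding independent_family_iff[OF assms(2)] by (auto simp: traces_def)
qed

lemma contains_independent_seqI:
  assumes "finite I" "n \<le> card I" "a ` I \<subseteq> X" "independent_family I a"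
  shows "contains_independent_seq X n"
proof -
  obtain J where J: "J \<subseteq> I" "card J = n"
    using assms(2) obtain_subset_with_card_n by blast
  then have "finite J" using assms(1) finite_subset by blast
  then obtain h where h: "bij_betw h {..<n} J"
    using J(2) by (metis atLeast0LessThan ex_bij_betw_nat_finite)
  have "independent_family {..<n} (a \<circ> h)"
    by (rule independent_family_reindex[OF h])
      (use independent_family_subset[OF assms(4) J(1)] in auto)
  moreover have "(a \<circ> h) ` {..<n} \<subseteq> X"
    using h J(1) assms(3) by (auto simp: bij_betw_def)
  ultimately show ?thesis unfolding contains_independent_seq_def by blast
qed

lemma contains_independent_seq_antimono:
  "contains_independent_seq X n \<Longrightarrow> m \<le> n \<Longrightarrow> contains_independent_seq X m"
  unfolding contains_independent_seq_def[of X n]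
  by (metis card_lessThan contains_independent_seqI finite_lessThan)

lemma contains_independent_seq_mono:
  "contains_independent_seq X n \<Longrightarrow> X \<subseteq> Y \<Longrightarrow> contains_independent_seq Y n"
  unfolding contains_independent_seq_def by (meson subset_trans)

lemma card_traces_le:
  assumes "finite I" "a ` I \<subseteq> X" "\<not> contains_independent_seq X n"
  shows "card (traces I a) \<le> (card I + 1) ^ n"
proof (rule sauer_shelah[OF assms(1)])
  show "traces I a \<subseteq> Pow I" by (auto simp: traces_def)
  fix J assume J: "J \<subseteq> I" "shatters (traces I a) J"
  then have "finite J" "a ` J \<subseteq> X" using assms finite_subset by blast+
  with J show "card J < n"
    using assms(3) shatters_traces_imp_independent contains_independent_seqI not_less by metis
qed

section \<open>Sets with bounded independence\<close>

definition bounded_independence :: "'a::boolean_algebra set \<Rightarrow> bool" where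
  "bounded_independence X \<longleftrightarrow> (\<exists>n. \<not> contains_independent_seq X n)"

lemma bounded_independence_Un:
  assumes "bounded_independence X" "bounded_independence Y"
  shows "bounded_independence (X \<union> Y)"
proof -
  obtain n m where nm: "\<not> contains_independent_seq X n" "\<not> contains_independent_seq Y m"
    using assms by (auto simp: bounded_independence_def)
  have "\<not> contains_independent_seq (X \<union> Y) (n + m)"
  proof
    assume "contains_independent_seq (X \<union> Y) (n + m)"
    then obtain a where a: "a ` {..<n + m} \<subseteq> X \<union> Y" "independent_family {..<n + m} a"
      by (auto simp: contains_independent_seq_def)
    let ?I = "{i \<in> {..<n + m}. a i \<in> X}" and ?J = "{i \<in> {..<n + m}. a i \<in> Y}"
    have "n + m = card (?I \<union> ?J)"
      using a(1) by (subst (1) card_lessThan[symmetric], intro arg_cong[of _ _ card]) auto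
    also have "\<dots> \<le> card ?I + card ?J" by (rule card_Un_le)
    finally consider "n \<le> card ?I" | "m \<le> card ?J" by linarith
    then show False
    proof cases
      case 1
      have "contains_independent_seq X n"
        by (rule contains_independent_seqI[OF _ 1 _ independent_family_subset[OF a(2)]]) auto
      with nm show False by blast
    next
      case 2
      have "contains_independent_seq Y m"
        by (rule contains_independent_seqI[OF _ 2 _ independent_family_subset[OF a(2)]]) auto
      with nm show False by blast
    qed
  qed
  then show ?thesis by (auto simp: bounded_independence_def)
qed

text \<open>Complementing all members of a sequence exchanges each sign pattern with its complement.\<close>
lemma independent_family_uminus:
  assumes "finite I" "independent_family I a"
  shows "independent_family I (\<lambda>i. - a i)"
proof -
  have tr: "traces I a = Pow I" using assms independent_family_iff by blast
  have "S \<in> traces I (\<lambda>i. - a i)" if S: "S \<subseteq> I" for S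
  proof -
    have "I - S \<in> traces I a" using tr by blast
    moreover have "I - (I - S) = S" using S by blast
    ultimately show ?thesis using S by (auto simp: traces_def)
  qed
  then show ?thesis unfolding independent_family_iff[OF assms(1)] by (auto simp: traces_def)
qed

lemma bounded_independence_uminus:
  assumes "bounded_independence X"
  shows "bounded_independence (uminus ` X)"
proof -
  have "contains_independent_seq X n" if ind: "contains_independent_seq (uminus ` X) n" for n
  proof -
    from ind obtain a where a: "a ` {..<n} \<subseteq> uminus ` X" "independent_family {..<n} a"
      by (auto simp: contains_independent_seq_def)
    have "(\<lambda>i. - a i) ` {..<n} \<subseteq> X" using a(1) by force
    then show ?thesis
      using independent_family_uminus[OF _ a(2)] by (auto simp: contains_independent_seq_def)
  qed
  then show ?thesis using assms by (auto simp: bounded_independence_def)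
qed

text \<open>
  Being below \<open>b i\<close> or below \<open>- b i\<close> persists for smaller elements, so the indices can be treated
  one at a time: a nonzero \<open>z\<close> cannot be disjoint from both \<open>b i\<close> and \<open>- b i\<close>.
\<close>
lemma ex_nonzero_deciding:
  fixes z :: "'a::boolean_algebra"
  assumes "finite I" "z \<noteq> bot"
  shows "\<exists>w\<le>z. w \<noteq> bot \<and> (\<forall>i\<in>I. w \<le> b i \<or> w \<le> - b i)"
  using assms(1)
proof (induction I rule: finite_induct)
  case empty
  then show ?case using assms(2) by blast
next
  case (insert i I)
  then obtain w where w: "w \<le> z" "w \<noteq> bot" "\<forall>i\<in>I. w \<le> b i \<or> w \<le> - b i" by blast
  have "w = sup (inf w (b i)) (inf w (- b i))"
    by (simp add: inf_sup_distrib1[symmetric])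
  then have "inf w (b i) \<noteq> bot \<or> inf w (- b i) \<noteq> bot"
    using w(2) by force
  then obtain v where v: "v \<noteq> bot" "v \<le> w" "v \<le> b i \<or> v \<le> - b i"
    using inf_le1 inf_le2 by metis
  then have "\<forall>j\<in>insert i I. v \<le> b j \<or> v \<le> - b j"
    using w(3) order_trans by blast
  then show ?case using v w(1) order_trans by blast
qed

text \<open>
  A nonzero element inside the cell can be shrunk until it lies in a cell of \<open>x\<close> and in a cell of
  \<open>y\<close>; it is then below \<open>inf (x i) (y i)\<close> exactly for the indices that both sign patterns contain.
\<close>
lemma traces_inf_subset:
  assumes "finite I"
  shows "traces I (\<lambda>i. inf (x i) (y i)) \<subseteq> (\<lambda>(S, T). S \<inter> T) ` (traces I x \<times> traces I y)"
proof
  fix U assume "U \<in> traces I (\<lambda>i. inf (x i) (y i))"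
  then obtain z where U: "U \<subseteq> I" and z: "z \<noteq> bot" "\<forall>i\<in>U. z \<le> inf (x i) (y i)"
      "\<forall>i\<in>I - U. z \<le> - inf (x i) (y i)"
    unfolding traces_def mem_Collect_eq by metis
  obtain v where v: "v \<le> z" "v \<noteq> bot" "\<forall>i\<in>I. v \<le> x i \<or> v \<le> - x i"
    using ex_nonzero_deciding[OF assms z(1)] by blast
  obtain w where w: "w \<le> v" "w \<noteq> bot" "\<forall>i\<in>I. w \<le> y i \<or> w \<le> - y i"
    using ex_nonzero_deciding[OF assms v(2)] by blast
  have wz: "w \<le> z" using w(1) v(1) by (rule order_trans)
  define S where "S = {i \<in> I. w \<le> x i}"
  define T where "T = {i \<in> I. w \<le> y i}"
  have "\<forall>i\<in>I. w \<le> x i \<or> w \<le> - x i" using v(3) order_trans[OF w(1)] by blast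
  then have "S \<in> traces I x" "T \<in> traces I y"
    using w(2,3) by (auto simp: traces_def S_def T_def)
  moreover have "U = S \<inter> T"
  proof (intro equalityI subsetI)
    fix i assume "i \<in> U"
    then have "w \<le> inf (x i) (y i)" using z(2) order_trans[OF wz] by blast
    then show "i \<in> S \<inter> T" using \<open>i \<in> U\<close> U by (auto simp: S_def T_def)
  next
    fix i assume i: "i \<in> S \<inter> T"
    show "i \<in> U"
    proof (rule ccontr)
      assume "i \<notin> U"
      moreover have "i \<in> I" using i by (simp add: S_def)
      ultimately have "w \<le> - inf (x i) (y i)" using z(3) order_trans[OF wz] by blast
      moreover have "w \<le> inf (x i) (y i)" using i by (auto simp: S_def T_def)
      ultimately have "w \<le> inf (inf (x i) (y i)) (- inf (x i) (y i))"
        by (rule inf_greatest[rotated])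
      also have "\<dots> = bot" by (rule inf_compl_bot)
      finally show False using w(2) by (simp add: bot_unique)
    qed
  qed
  ultimately show "U \<in> (\<lambda>(S, T). S \<inter> T) ` (traces I x \<times> traces I y)" by blast
qed

lemma bounded_independence_inf:
  assumes "bounded_independence X" "bounded_independence Y"
  shows "bounded_independence {inf x y |x y. x \<in> X \<and> y \<in> Y}"
proof -
  obtain n m where nm: "\<not> contains_independent_seq X n" "\<not> contains_independent_seq Y m"
    using assms by (auto simp: bounded_independence_def)
  obtain N where N: "(N + 1) ^ (n + m) < (2::nat) ^ N"
    using ex_power_less_exp by blast
  have "\<not> contains_independent_seq {inf x y |x y. x \<in> X \<and> y \<in> Y} N"
  proof
    assume "contains_independent_seq {inf x y |x y. x \<in> X \<and> y \<in> Y} N"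
    then obtain c where c: "c ` {..<N} \<subseteq> {inf x y |x y. x \<in> X \<and> y \<in> Y}"
        "independent_family {..<N} c"
      by (auto simp: contains_independent_seq_def)
    have "\<forall>i\<in>{..<N}. \<exists>x y. x \<in> X \<and> y \<in> Y \<and> c i = inf x y" using c(1) by blast
    then obtain x y where xy: "\<And>i. i < N \<Longrightarrow> x i \<in> X \<and> y i \<in> Y \<and> c i = inf (x i) (y i)"
      by (metis lessThan_iff)
    let ?I = "{..<N}"
    have fin: "finite (traces ?I a)" for a :: "nat \<Rightarrow> 'a"
      by (rule finite_subset[of _ "Pow ?I"]) (auto simp: traces_def)
    have "traces ?I (\<lambda>i. inf (x i) (y i)) = traces ?I c"
      using xy by (intro traces_cong) simp
    also have "\<dots> = Pow ?I" using c(2) independent_family_iff by blast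
    finally have "2 ^ N = card (traces ?I (\<lambda>i. inf (x i) (y i)))"
      by (simp add: card_Pow)
    also have "\<dots> \<le> card ((\<lambda>(S, T). S \<inter> T) ` (traces ?I x \<times> traces ?I y))"
      by (intro card_mono traces_inf_subset) (simp_all add: fin)
    also have "\<dots> \<le> card (traces ?I x) * card (traces ?I y)"
      using card_image_le[of "traces ?I x \<times> traces ?I y" "\<lambda>(S, T). S \<inter> T"]
      by (simp add: fin card_cartesian_product)
    also have "\<dots> \<le> (N + 1) ^ n * (N + 1) ^ m"
      using card_traces_le[of ?I x X n] card_traces_le[of ?I y Y m] nm xy
      by (intro mult_mono) auto
    also have "\<dots> = (N + 1) ^ (n + m)" by (simp add: power_add)
    finally show False using N by simp
  qed
  then show ?thesis by (auto simp: bounded_independence_def)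
qed

lemma bounded_independence_bot_top: "bounded_independence {bot, top :: 'a::boolean_algebra}"
proof -
  have "\<not> contains_independent_seq {bot, top :: 'a} 1"
  proof
    assume "contains_independent_seq {bot, top :: 'a} 1"
    then obtain a :: "nat \<Rightarrow> 'a" where a: "a 0 = bot \<or> a 0 = top" "traces {..<1} a = Pow {..<1}"
      by (auto simp: contains_independent_seq_def independent_family_iff)
    then have "{} \<in> traces {..<1} a" "{0} \<in> traces {..<1} a" by auto
    then show False using a(1) by (auto simp: traces_def bot_unique)
  qed
  then show ?thesis by (auto simp: bounded_independence_def)
qed

section \<open>Exhausting the generated algebra\<close>

primrec stage :: "(nat \<Rightarrow> 'a::boolean_algebra set) \<Rightarrow> nat \<Rightarrow> 'a set" where
  "stage G 0 = {bot, top}"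
| "stage G (Suc k) = stage G k \<union> G (Suc k) \<union> uminus ` stage G k
     \<union> {inf x y |x y. x \<in> stage G k \<and> y \<in> stage G k}"

lemma stage_mono: "k \<le> l \<Longrightarrow> stage G k \<subseteq> stage G l"
  by (rule lift_Suc_mono_le[of "stage G"]) auto

lemma bounded_independence_stage:
  assumes "\<And>n. n \<ge> 1 \<Longrightarrow> bounded_independence (G n)"
  shows "bounded_independence (stage G k)"
  by (induction k)
    (simp_all add: assms bounded_independence_bot_top bounded_independence_Un
      bounded_independence_uminus bounded_independence_inf del: Un_insert_left Un_insert_right)

lemma stage_subset:
  assumes "boolean_subalgebra A" "(\<Union>n\<in>{1..}. G n) \<subseteq> A"
  shows "stage G k \<subseteq> A"
proof (induction k)
  case 0
  then show ?case using assms(1) by (simp add: boolean_subalgebra_def)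
next
  case (Suc k)
  have "G (Suc k) \<subseteq> A" using assms(2) by force
  moreover have "inf x y \<in> A" if "x \<in> stage G k" "y \<in> stage G k" for x y
    using that Suc assms(1) unfolding boolean_subalgebra_def by (meson subsetD)
  ultimately show ?case using Suc assms(1) by (auto simp: boolean_subalgebra_def)
qed

lemma boolean_subalgebra_Union_stage: "boolean_subalgebra (\<Union>k. stage G k)"
proof -
  let ?W = "\<Union>k. stage G k"
  have compl: "- x \<in> ?W" if "x \<in> ?W" for x
  proof -
    from that obtain k where "x \<in> stage G k" by blast
    then have "- x \<in> stage G (Suc k)" by simp
    then show ?thesis by blast
  qed
  have meet: "inf x y \<in> ?W" if xy: "x \<in> ?W" "y \<in> ?W" for x y
  proof -
    from xy obtain k l where "x \<in> stage G k" "y \<in> stage G l" by blast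
    then have "x \<in> stage G (max k l)" "y \<in> stage G (max k l)"
      using stage_mono[of k "max k l" G] stage_mono[of l "max k l" G] by auto
    then have "inf x y \<in> stage G (Suc (max k l))" by auto
    then show ?thesis by blast
  qed
  have join: "sup x y \<in> ?W" if "x \<in> ?W" "y \<in> ?W" for x y
  proof -
    \<comment> \<open>\<^const>\<open>stage\<close> adjoins no joins: they arise from meets and complements.\<close>
    have "- inf (- x) (- y) \<in> ?W" using that by (intro compl meet)
    then show ?thesis by simp
  qed
  have "{bot, top} \<subseteq> ?W" using stage.simps(1)[of G] by blast
  with compl meet join show ?thesis by (auto simp: boolean_subalgebra_def)
qed

lemma hull_eq_Union_stage:
  "boolean_subalgebra hull (\<Union>n\<in>{1..}. G n) = (\<Union>k. stage G k)"
proof (rule hull_unique)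
  show "(\<Union>n\<in>{1..}. G n) \<subseteq> (\<Union>k. stage G k)"
  proof
    fix x assume "x \<in> (\<Union>n\<in>{1..}. G n)"
    then obtain n where "n \<ge> 1" "x \<in> G n" by auto
    then obtain k where "n = Suc k" by (cases n) auto
    with \<open>x \<in> G n\<close> have "x \<in> stage G (Suc k)" by simp
    then show "x \<in> (\<Union>k. stage G k)" by blast
  qed
  show "boolean_subalgebra (\<Union>k. stage G k)" by (rule boolean_subalgebra_Union_stage)
  show "(\<Union>k. stage G k) \<subseteq> B" if "(\<Union>n\<in>{1..}. G n) \<subseteq> B" "boolean_subalgebra B" for B
    using stage_subset[OF that(2,1)] by blast
qed

text \<open>
  The \<open>n\<close>-th piece collects all \<open>W k\<close> without independent sequences of length \<open>n\<close>. Since the \<open>W k\<close>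
  form a chain, finitely many members of the piece already lie in one such \<open>W k\<close>.
\<close>
lemma ex_decomposition_of_chain:
  fixes W :: "nat \<Rightarrow> 'a::boolean_algebra set"
  assumes "mono W" "\<And>k. bounded_independence (W k)"
  shows "\<exists>E :: nat \<Rightarrow> 'a set. (\<Union>k. W k) = (\<Union>n\<in>{1..}. E n) \<and>
    (\<forall>n\<ge>1. \<not> contains_independent_seq (E n) n)"
proof -
  define K where "K n = {k. \<not> contains_independent_seq (W k) n}" for n
  have "\<exists>n\<ge>1. k \<in> K n" for k
  proof -
    obtain n where "\<not> contains_independent_seq (W k) n"
      using assms(2) by (auto simp: bounded_independence_def)
    then have "k \<in> K (Suc n)"
      using contains_independent_seq_antimono[of "W k" "Suc n" n] by (auto simp: K_def)
    then show ?thesis by force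
  qed
  then have "(\<Union>k. W k) = (\<Union>n\<in>{1..}. \<Union>k\<in>K n. W k)" by fastforce
  moreover have "\<not> contains_independent_seq (\<Union>k\<in>K n. W k) n" if "n \<ge> 1" for n
  proof
    assume "contains_independent_seq (\<Union>k\<in>K n. W k) n"
    then obtain a where a: "a ` {..<n} \<subseteq> (\<Union>k\<in>K n. W k)" "independent_family {..<n} a"
      by (auto simp: contains_independent_seq_def)
    then have "\<forall>i\<in>{..<n}. \<exists>k\<in>K n. a i \<in> W k" by blast
    then obtain f where f: "\<And>i. i < n \<Longrightarrow> f i \<in> K n \<and> a i \<in> W (f i)"
      by (metis lessThan_iff)
    define l where "l = Max (f ` {..<n})"
    have "f ` {..<n} \<noteq> {}" using that by (auto simp: lessThan_empty_iff)
    then have "l \<in> f ` {..<n}" unfolding l_def by (intro Max_in) auto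
    then have "l \<in> K n" using f by auto
    moreover have "a i \<in> W l" if "i < n" for i
    proof -
      have "f i \<le> l" unfolding l_def using that by (intro Max_ge) auto
      then show ?thesis using f[OF that] monoD[OF assms(1)] by blast
    qed
    ultimately show False
      using a(2) by (auto simp: K_def contains_independent_seq_def)
  qed
  ultimately show ?thesis by (intro exI[of _ "\<lambda>n. \<Union>k\<in>K n. W k"]) blast
qed

lemma UWRN_imp_decomposition:
  assumes "UWRN A"
  shows "\<exists>E :: nat \<Rightarrow> 'a::boolean_algebra set. A = (\<Union>n\<in>{1..}. E n) \<and>
    (\<forall>n\<ge>1. \<not> contains_independent_seq (E n) n)"
proof -
  obtain G where G: "boolean_subalgebra hull (\<Union>n\<in>{1..}. G n) = A"
      "\<forall>n\<ge>1. \<not> contains_independent_seq (G n) n"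
    using assms by (auto simp: UWRN_def)
  have "bounded_independence (stage G k)" for k
    using G(2) by (intro bounded_independence_stage) (auto simp: bounded_independence_def)
  moreover have "mono (stage G)" by (intro monoI stage_mono)
  ultimately show ?thesis
    using ex_decomposition_of_chain[of "stage G"] G(1) hull_eq_Union_stage by metis
qed

lemma decomposition_imp_UWRN:
  assumes "boolean_subalgebra A" "A = (\<Union>n\<in>{1..}. E n)"
    "\<forall>n\<ge>1. \<not> contains_independent_seq (E n) n"
  shows "UWRN A"
  unfolding UWRN_def using assms hull_same[of boolean_subalgebra A] by metis

theorem corollary7p3:
  fixes A :: "'a::boolean_algebra set"
  assumes "boolean_subalgebra A"
  shows "(UWRN A \<longleftrightarrow>
            (\<exists>E :: nat \<Rightarrow> 'a set. A = (\<Union>n\<in>{1..}. E n) \<and>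
               (\<forall>n\<ge>1. \<not> contains_independent_seq (E n) n))) \<and>
         (\<forall>B. UWRN A \<and> boolean_subalgebra B \<and> B \<subseteq> A \<longrightarrow> UWRN B)"
proof (intro conjI allI impI iffI; (elim conjE exE)?)
  assume "UWRN A"
  then show "\<exists>E :: nat \<Rightarrow> 'a set. A = (\<Union>n\<in>{1..}. E n) \<and>
      (\<forall>n\<ge>1. \<not> contains_independent_seq (E n) n)"
    by (rule UWRN_imp_decomposition)
next
  fix E :: "nat \<Rightarrow> 'a set"
  assume "A = (\<Union>n\<in>{1..}. E n)" "\<forall>n\<ge>1. \<not> contains_independent_seq (E n) n"
  then show "UWRN A" by (rule decomposition_imp_UWRN[OF assms])
next
  fix B assume B: "UWRN A" "boolean_subalgebra B" "B \<subseteq> A"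
  obtain E :: "nat \<Rightarrow> 'a set" where E: "A = (\<Union>n\<in>{1..}. E n)"
      "\<forall>n\<ge>1. \<not> contains_independent_seq (E n) n"
    using UWRN_imp_decomposition[OF B(1)] by blast
  show "UWRN B"
  proof (rule decomposition_imp_UWRN[OF B(2)])
    show "B = (\<Union>n\<in>{1..}. B \<inter> E n)" using B(3) E(1) by blast
    show "\<forall>n\<ge>1. \<not> contains_independent_seq (B \<inter> E n) n"
      using E(2) contains_independent_seq_mono[of "B \<inter> E _" _ "E _"] by blast
  qed
qed

end
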